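(* Let $(L,A,\cdot,\ell)$ be a left-symmetric Rinehart algebra over a field $\mathbb K$ of characteristic zero, and let $[x,y]=x\cdot y-y\cdot x$ for $x,y\in L$. Then $(L,A,[\cdot,\cdot],\ell)$ is a Lie-Rinehart algebra (called the sub-adjacent Lie-Rinehart algebra of $(L,A,\cdot,\ell)$).
   Context: All vector spaces are over a field $\mathbb K$ of characteristic zero. A left-symmetric algebra is a vector space $L$ with a bilinear product $\cdot$ such that $(x\cdot y)\cdot z-x\cdot(y\cdot z)=(y\cdot x)\cdot z-y\cdot(x\cdot z)$ for all $x,y,z\in L$. A left-symmetric Rinehart algebra is a quadruple $(L,A,\cdot,\ell)$ where $(L,\cdot)$ is a left-symmetric algebra, $A$ is an associative commutative $\mathbb K$-algebra, $L$ is an $A$-module, and $\ell:L\to \mathrm{Der}(A)$ is a linear map such that for all $a\in A$, $x,y\in L$: $\ell(x\cdot y-y\cdot x)=\ell(x)\ell(y)-\ell(y)\ell(x)$, $\ell(ax)=a\ell(x)$, $x\cdot(ay)=\ell(x)(a)\,y+a(x\cdot y)$, and $(ax)\cdot y=a(x\cdot y)$. A Lie-Rinehart algebra $(L,A,[\cdot,\cdot],\rho)$ over an associative commutative algebra $A$ is a Lie algebra $(L,[\cdot,\cdot])$ over $\mathbb K$ with an $A$-module structure and a linear map $\rho:L\to\mathrm{Der}(A)$ such that $\rho([x,y])=\rho(x)\rho(y)-\rho(y)\rho(x)$, $\rho(ax)=a\rho(x)$ and $[x,ay]=\rho(x)(a)\,y+a[x,y]$ for all $a\in A$, $x,y\in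 L$. *)

theory Defs
  imports Complex_Main "HOL-Library.Function_Algebras"
begin

text \<open>
  Vector spaces, algebras and modules live on whole types; the scalar actions are explicit
  parameters, as in the library locale \<open>vector_space\<close>. Addition and subtraction of maps are
  the pointwise ones of \<open>Function_Algebras\<close>.
\<close>

locale bilinear_map =
  fixes s1 :: "'k::field_char_0 \<Rightarrow> 'u::ab_group_add \<Rightarrow> 'u"
    and s2 :: "'k \<Rightarrow> 'v::ab_group_add \<Rightarrow> 'v"
    and s3 :: "'k \<Rightarrow> 'w::ab_group_add \<Rightarrow> 'w"
    and b :: "'u \<Rightarrow> 'v \<Rightarrow> 'w"
  assumes linear_left: "Vector_Spaces.linear s1 s3 (\<lambda>u. b u v)"
    and linear_right: "Vector_Spaces.linear s2 s3 (\<lambda>v. b u v)"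

text \<open>Associativity and commutativity come from the class \<open>comm_ring\<close>; no unit is required.\<close>

locale comm_assoc_algebra = bilinear_map sA sA sA "(*)"
  for sA :: "'k::field_char_0 \<Rightarrow> 'a::comm_ring \<Rightarrow> 'a"

definition Der :: "('k::field_char_0 \<Rightarrow> 'a::comm_ring \<Rightarrow> 'a) \<Rightarrow> ('a \<Rightarrow> 'a) set" where
  "Der sA = {D. Vector_Spaces.linear sA sA D \<and> (\<forall>a b. D (a * b) = D a * b + a * D b)}"

text \<open>
  The action is \<open>\<bbbK>\<close>-bilinear, as for any module over a \<open>\<bbbK>\<close>-algebra. If the algebra happens
  to have a unit, the module is required to be unital; see \<open>algebra_module_iff_module\<close> below.
\<close>

locale algebra_module =
  alg: comm_assoc_algebra sA + action: bilinear_map sA sL sL act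
  for sA :: "'k::field_char_0 \<Rightarrow> 'a::comm_ring \<Rightarrow> 'a"
    and sL :: "'k \<Rightarrow> 'l::ab_group_add \<Rightarrow> 'l"
    and act :: "'a \<Rightarrow> 'l \<Rightarrow> 'l" +
  assumes act_mult: "act (a * b) x = act a (act b x)"
    and act_unit: "(\<And>a. e * a = a) \<Longrightarrow> act e x = x"

locale left_symmetric_algebra = bilinear_map sL sL sL m
  for sL :: "'k::field_char_0 \<Rightarrow> 'l::ab_group_add \<Rightarrow> 'l"
    and m :: "'l \<Rightarrow> 'l \<Rightarrow> 'l" +
  assumes left_symmetric: "m (m x y) z - m x (m y z) = m (m y x) z - m y (m x z)"

locale lie_algebra = bilinear_map sL sL sL br
  for sL :: "'k::field_char_0 \<Rightarrow> 'l::ab_group_add \<Rightarrow> 'l"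
    and br :: "'l \<Rightarrow> 'l \<Rightarrow> 'l" +
  assumes alternating: "br x x = 0"
    and jacobi: "br x (br y z) + br y (br z x) + br z (br x y) = 0"

locale left_symmetric_rinehart_algebra =
  left_symmetric_algebra sL m + algebra_module sA sL act
  for sA :: "'k::field_char_0 \<Rightarrow> 'a::comm_ring \<Rightarrow> 'a"
    and sL :: "'k \<Rightarrow> 'l::ab_group_add \<Rightarrow> 'l"
    and act :: "'a \<Rightarrow> 'l \<Rightarrow> 'l"
    and m :: "'l \<Rightarrow> 'l \<Rightarrow> 'l"
    and ell :: "'l \<Rightarrow> 'a \<Rightarrow> 'a" +
  assumes ell_Der: "ell x \<in> Der sA"
    and ell_linear: "Vector_Spaces.linear sL (\<lambda>k D b. sA k (D b)) ell"
    and ell_commutator: "ell (m x y - m y x) = (ell x \<circ> ell y) - (ell y \<circ> ell x)"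
    and ell_act: "ell (act a x) = (\<lambda>b. a * ell x b)"
    and mult_act_right: "m x (act a y) = act (ell x a) y + act a (m x y)"
    and mult_act_left: "m (act a x) y = act a (m x y)"

locale lie_rinehart_algebra =
  lie_algebra sL br + algebra_module sA sL act
  for sA :: "'k::field_char_0 \<Rightarrow> 'a::comm_ring \<Rightarrow> 'a"
    and sL :: "'k \<Rightarrow> 'l::ab_group_add \<Rightarrow> 'l"
    and act :: "'a \<Rightarrow> 'l \<Rightarrow> 'l"
    and br :: "'l \<Rightarrow> 'l \<Rightarrow> 'l"
    and rho :: "'l \<Rightarrow> 'a \<Rightarrow> 'a" +
  assumes rho_Der: "rho x \<in> Der sA"
    and rho_linear: "Vector_Spaces.linear sL (\<lambda>k D b. sA k (D b)) rho"
    and rho_bracket: "rho (br x y) = (rho x \<circ> rho y) - (rho y \<circ> rho x)"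
    and rho_act: "rho (act a x) = (\<lambda>b. a * rho x b)"
    and bracket_act_right: "br x (act a y) = act (rho x a) y + act a (br x y)"

text \<open>For unital algebras, the modules are those of the library.\<close>

lemma algebra_module_iff_module:
  fixes sA :: "'k::field_char_0 \<Rightarrow> 'a::comm_ring_1 \<Rightarrow> 'a"
    and sL :: "'k \<Rightarrow> 'l::ab_group_add \<Rightarrow> 'l"
  shows "algebra_module sA sL act \<longleftrightarrow>
    comm_assoc_algebra sA \<and> vector_space sL \<and> module act \<and>
    (\<forall>k a x. act (sA k a) x = sL k (act a x)) \<and> (\<forall>k a x. act a (sL k x) = sL k (act a x))"
    (is "?l \<longleftrightarrow> ?r")
proof
  assume l: ?l
  interpret algebra_module sA sL act by (fact l)
  have L1: "act a (x + y) = act a x + act a y" "act a (sL k x) = sL k (act a x)" for a x y k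
    using action.linear_right[of a]
    by (auto simp: Vector_Spaces.linear_iff_module_hom module_hom_def module_hom_axioms_def)
  have L2: "act (a + b) x = act a x + act b x" "act (sA k a) x = sL k (act a x)" for a b x k
    using action.linear_left[of x]
    by (auto simp: Vector_Spaces.linear_iff_module_hom module_hom_def module_hom_axioms_def)
  have "act 1 x = x" for x by (rule act_unit) simp
  then have "module act" by unfold_locales (simp_all add: L1 L2 act_mult)
  moreover have "vector_space sL"
    using Vector_Spaces.linear.axioms(1)[OF action.linear_right[of 0]] .
  ultimately show ?r using L1 L2 alg.comm_assoc_algebra_axioms by blast
next
  assume r: ?r
  interpret comm_assoc_algebra sA using r by blast
  interpret A: vector_space sA using Vector_Spaces.linear.axioms(1)[OF linear_right[of 0]] .
  interpret L: vector_space sL using r by blast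
  interpret M: module act using r by blast
  have lin: "Vector_Spaces.linear s t f"
    if "vector_space s" "vector_space t" "\<And>x y. f (x + y) = f x + f y" "\<And>k x. f (s k x) = t k (f x)"
    for s :: "'k \<Rightarrow> 'x::ab_group_add \<Rightarrow> 'x" and t :: "'k \<Rightarrow> 'y::ab_group_add \<Rightarrow> 'y" and f
    using that by (simp add: Vector_Spaces.linear_def module_hom_def module_hom_axioms_def
        module_iff_vector_space)
  have "bilinear_map sA sL sL act"
    using r
    by (intro bilinear_map.intro lin)
      (auto simp: A.vector_space_axioms M.scale_left_distrib M.scale_right_distrib)
  moreover have "act e x = x" if "\<And>a. e * a = a" for e x
    using that[of 1] by simp
  ultimately show ?l
    by (intro algebra_module.intro algebra_module_axioms.intro comm_assoc_algebra_axioms) simp_all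
qed

end

theory Submission
  imports Defs
begin

text \<open>Left symmetry says that left multiplications satisfy L_[x,y] = L_x L_y - L_y L_x, and
  this yields the Jacobi identity for the commutator (\<open>lie_algebra_commutator\<close>). The
  module structure and the conditions on \<open>ell\<close> alone carry over unchanged, so only the
  Leibniz rule for the bracket remains.\<close>

context bilinear_map
begin

lemma diff_left: "b (u - u') v = b u v - b u' v"
proof -
  interpret Vector_Spaces.linear s1 s3 "\<lambda>u. b u v" by (rule linear_left)
  show ?thesis by (rule diff)
qed

lemma diff_right: "b u (v - v') = b u v - b u v'"
proof -
  interpret Vector_Spaces.linear s2 s3 "\<lambda>v. b u v" by (rule linear_right)
  show ?thesis by (rule diff)
qed

end

lemma bilinear_map_commutator:
  assumes "bilinear_map s s t b"
  shows "bilinear_map s s t (\<lambda>x y. b x y - b y x)"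
proof -
  interpret bilinear_map s s t b by (fact assms)
  interpret vector_space_pair s t
    using linear_left by (simp add: Vector_Spaces.linear_def vector_space_pair_def)
  show ?thesis
    by (intro bilinear_map.intro linear_compose_sub linear_left linear_right)
qed

lemma (in left_symmetric_algebra) lie_algebra_commutator: "lie_algebra sL (\<lambda>x y. m x y - m y x)"
proof (intro lie_algebra.intro lie_algebra_axioms.intro bilinear_map_commutator
    bilinear_map_axioms)
  fix x y z
  \<comment> \<open>Used below only at the three cyclic instances, since the general equation would
    loop as a rewrite rule. Each instance cancels one pair of left-nested products; the right-nested
    ones then cancel too.\<close>
  have swap: "m (m x y) z = m x (m y z) + m (m y x) z - m y (m x z)" for x y z
    using left_symmetric[of x y z] by (simp add: algebra_simps)
  show "m x (m y z - m z y) - m (m y z - m z y) x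
      + (m y (m z x - m x z) - m (m z x - m x z) y)
      + (m z (m x y - m y x) - m (m x y - m y x) z) = 0"
    by (simp add: diff_left diff_right swap[of x y z] swap[of y z x] swap[of z x y] algebra_simps)
qed simp

theorem theorem3p5:
  fixes sA :: "'k::field_char_0 \<Rightarrow> 'a::comm_ring \<Rightarrow> 'a"
    and sL :: "'k \<Rightarrow> 'l::ab_group_add \<Rightarrow> 'l"
    and act :: "'a \<Rightarrow> 'l \<Rightarrow> 'l"
    and m :: "'l \<Rightarrow> 'l \<Rightarrow> 'l"
    and ell :: "'l \<Rightarrow> 'a \<Rightarrow> 'a"
  assumes "left_symmetric_rinehart_algebra sA sL act m ell"
  shows "lie_rinehart_algebra sA sL act (\<lambda>x y. m x y - m y x) ell"
proof -
  interpret left_symmetric_rinehart_algebra sA sL act m ell by (fact assms)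
  show ?thesis
  proof (intro lie_rinehart_algebra.intro lie_rinehart_algebra_axioms.intro
      lie_algebra_commutator algebra_module_axioms ell_Der ell_linear ell_commutator ell_act)
    fix x y a
    \<comment> \<open>The product is A-linear in its first argument, so the derivation term comes
      from \<open>m x (act a y)\<close> alone.\<close>
    show "m x (act a y) - m (act a y) x = act (ell x a) y + act a (m x y - m y x)"
      by (simp add: mult_act_right mult_act_left action.diff_right)
  qed
qed

end
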